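(* There exists a continuum $X=L\cup J\cup R$ belonging to the class $\mathcal{C}$, with $L$ and $R$ being disjoint arcs, such that $$\mathcal{M}(X)=\mathcal{M}(J)\sqcup\mathcal{M}(L)\sqcup\mathcal{M}(R).$$
   Context: A continuum is a nonempty compact connected metrizable space. An arc is a space homeomorphic to $[0,1]$. A ray is a space homeomorphic to $[0,\infty)$. A free interval in a space is an open subset homeomorphic to $(0,1)$. The class $\mathcal{C}$ consists of all continua $X$ that can be written as $X=L\cup J\cup R$, where $J$ is a free interval dense in $X$, and $L,R$ are (nowhere dense) locally connected continua (possibly singletons) disjoint from $J$ such that, for some rays $J_L,J_R$ with $J=J_L\cup J_R$, the set $L\cup J_L$ is a compactification of $J_L$ (with remainder $L$) and $R\cup J_R$ is a compactification of $J_R$ (with remainder $R$). Writing "$X=L\cup J\cup R$ belongs to $\mathcal{C}$" means that $L,J,R$ are as in this definition. A continuous map $g\colon M\to M$ of a nonempty compact metrizable space $M$ is minimal (and $(M,g)$ is a minimal dynamical system) if no nonempty proper closed subset $N\subseteq M$ satisfies $g(N)\subseteq N$. For a metrizable (not necessarily compact) space $Y$, $\mathcal{M}(Y)$ denotes the system of all (nonempty) compact sets $M\subseteq Y$ for which there is a continuous map $f\colon Y\to Y$ with $f(M)=M$ and $(M,f|_M)$ a minimal dynamical system. The symbol $\sqcup$ between systems of sets denotes a union of pairwise disjoint systems. *)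

theory Defs
  imports "HOL-Analysis.Analysis"
begin

text \<open>
  A space is a value \<open>X\<close> of type \<open>'a topology\<close>; its points are \<open>topspace X\<close>, and a subset \<open>A\<close>
  of a space is regarded as a space through \<open>subtopology X A\<close>. Since \<open>subtopology X A\<close> silently
  cuts \<open>A\<close> down to \<open>A \<inter> topspace X\<close>, every predicate on subsets states \<open>A \<subseteq> topspace X\<close>
  unless that follows from another conjunct.
\<close>

definition continuum_space :: "'a topology \<Rightarrow> bool" where
  "continuum_space X \<longleftrightarrow>
     topspace X \<noteq> {} \<and> compact_space X \<and> connected_space X \<and> metrizable_space X"

definition arc_in :: "'a topology \<Rightarrow> 'a set \<Rightarrow> bool" where
  "arc_in X A \<longleftrightarrow>
     A \<subseteq> topspace X \<and> subtopology X A homeomorphic_space top_of_set {0..1::real}"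

definition ray_in :: "'a topology \<Rightarrow> 'a set \<Rightarrow> bool" where
  "ray_in X A \<longleftrightarrow>
     A \<subseteq> topspace X \<and> subtopology X A homeomorphic_space top_of_set {0::real..}"

definition free_interval_in :: "'a topology \<Rightarrow> 'a set \<Rightarrow> bool" where
  "free_interval_in X A \<longleftrightarrow>
     openin X A \<and> subtopology X A homeomorphic_space top_of_set {0<..<1::real}"

definition dense_in :: "'a topology \<Rightarrow> 'a set \<Rightarrow> bool" where
  "dense_in X A \<longleftrightarrow> A \<subseteq> topspace X \<and> X closure_of A = topspace X"

definition nowhere_dense_in :: "'a topology \<Rightarrow> 'a set \<Rightarrow> bool" where
  "nowhere_dense_in X A \<longleftrightarrow> A \<subseteq> topspace X \<and> X interior_of (X closure_of A) = {}"

definition locally_connected_continuum_in :: "'a topology \<Rightarrow> 'a set \<Rightarrow> bool" where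
  "locally_connected_continuum_in X A \<longleftrightarrow>
     A \<subseteq> topspace X \<and> continuum_space (subtopology X A) \<and>
     locally_connected_space (subtopology X A)"

text \<open>The subspace \<open>K\<close> of \<open>X\<close> is a compactification of its subspace \<open>P\<close>, with remainder \<open>Q\<close>.\<close>

definition compactification_in :: "'a topology \<Rightarrow> 'a set \<Rightarrow> 'a set \<Rightarrow> 'a set \<Rightarrow> bool" where
  "compactification_in X K P Q \<longleftrightarrow>
     K \<subseteq> topspace X \<and> P \<subseteq> K \<and>
     compact_space (subtopology X K) \<and> Hausdorff_space (subtopology X K) \<and>
     dense_in (subtopology X K) P \<and> K - P = Q"

text \<open>\<open>class_C X L J R\<close>: the continuum \<open>X = L \<union> J \<union> R\<close> belongs to the class \<open>\<C>\<close>, with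
  \<open>L\<close>, \<open>J\<close>, \<open>R\<close> as in the definition of that class.\<close>

definition class_C :: "'a topology \<Rightarrow> 'a set \<Rightarrow> 'a set \<Rightarrow> 'a set \<Rightarrow> bool" where
  "class_C X L J R \<longleftrightarrow>
     continuum_space X \<and> topspace X = L \<union> J \<union> R \<and>
     free_interval_in X J \<and> dense_in X J \<and>
     nowhere_dense_in X L \<and> nowhere_dense_in X R \<and>
     locally_connected_continuum_in X L \<and> locally_connected_continuum_in X R \<and>
     disjnt L J \<and> disjnt R J \<and>
     (\<exists>JL JR. ray_in X JL \<and> ray_in X JR \<and> J = JL \<union> JR \<and>
        compactification_in X (L \<union> JL) JL L \<and>
        compactification_in X (R \<union> JR) JR R)"

definition minimal_map :: "'a topology \<Rightarrow> ('a \<Rightarrow> 'a) \<Rightarrow> bool" where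
  "minimal_map M g \<longleftrightarrow>
     topspace M \<noteq> {} \<and> compact_space M \<and> metrizable_space M \<and> continuous_map M M g \<and>
     (\<nexists>N. closedin M N \<and> N \<noteq> {} \<and> N \<noteq> topspace M \<and> g ` N \<subseteq> N)"

text \<open>The system \<open>\<M>(Y)\<close>. No restriction of \<open>f\<close> to \<open>M\<close> needs to be formed, because
  \<^const>\<open>minimal_map\<close> depends only on the values of its map on the underlying space.\<close>

definition minimal_sets :: "'a topology \<Rightarrow> 'a set set" where
  "minimal_sets Y =
     {M. M \<noteq> {} \<and> compactin Y M \<and>
         (\<exists>f. continuous_map Y Y f \<and> f ` M = M \<and> minimal_map (subtopology Y M) f)}"

text \<open>Existence of a continuum is expressed by existence of a topology on a subset of a fixed type.
  A continuum has at most the cardinality of the real line, so up to homeomorphism all continua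
  occur as values of type \<open>continuum_points topology\<close>. The type serves only as a supply of points:
  the topology is arbitrary and need not be related to the Euclidean one.\<close>

type_synonym continuum_points = "real \<times> real"

end

(*
  Let X be the closure in the plane of a curve homeomorphic to the open interval that oscillates onto
  a vertical segment at either end: on the right as a sine wave of constant amplitude, on the left
  with amplitude alternating between 1 and 1/2 in longer and longer blocks. The two segments L, R and
  the curve J are the path components of X, so a continuous map f sends each of them into one of
  them. Going through the combinations, f can have a minimal set that meets two of them only if
  f(J) <= J, f(L) <= R and f(R) <= L. But then f carries the right end of J over the left end, but
  within one period of the sine wave f can make only boundedly many oscillations, so it cannot get
  across the long blocks of small waves without returning to full height.
  Conversely, the pieces are intervals, so by Tietze's theorem whether M is minimal for some map
  does not depend on whether the map lives on a piece or on X.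
*)

theory Submission
  imports Defs
begin

section \<open>Minimal sets in subspaces that are intervals\<close>

lemma minimal_map_cong:
  assumes "\<And>x. x \<in> topspace M \<Longrightarrow> f x = g x"
  shows "minimal_map M f \<longleftrightarrow> minimal_map M g"
proof -
  have "continuous_map M M f \<longleftrightarrow> continuous_map M M g"
    using continuous_map_eq[of M M f g] continuous_map_eq[of M M g f] assms by fastforce
  moreover have "f ` N = g ` N" if "closedin M N" for N
    using closedin_subset[OF that] by (intro image_cong refl assms) blast
  ultimately show ?thesis
    unfolding minimal_map_def by (metis (no_types, lifting))
qed

lemma minimal_map_closed_invariant:
  assumes "minimal_map M g" "closedin M N" "N \<noteq> {}" "g ` N \<subseteq> N"
  shows "N = topspace M"
  using assms unfolding minimal_map_def by blast

text \<open>Conjugation by a homeomorphism of \<open>A\<close> with \<open>T\<close> turns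
  \<open>g\<close> into a real function on \<open>M\<close>, which Tietze extends within
  \<open>T\<close>. Tietze is applied to \<open>M\<close>, closed because compact, so that
  \<open>A\<close> itself may be open.\<close>

lemma extend_map_into_interval:
  fixes T :: "real set"
  assumes Z: "metrizable_space Z" and A: "A \<subseteq> topspace Z"
    and hom: "subtopology Z A homeomorphic_space top_of_set T" and T: "is_interval T"
    and M: "compactin Z M" "M \<subseteq> A" "M \<noteq> {}"
    and g: "continuous_map (subtopology Z M) Z g" "g ` M \<subseteq> A"
  obtains F where "continuous_map Z (subtopology Z A) F" "\<And>x. x \<in> M \<Longrightarrow> F x = g x"
proof -
  obtain h k where h: "continuous_map (subtopology Z A) (top_of_set T) h"
    and k: "continuous_map (top_of_set T) (subtopology Z A) k"
    and kh: "\<And>x. x \<in> A \<Longrightarrow> k (h x) = x"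
    using hom A unfolding homeomorphic_space_def homeomorphic_maps_def by (auto simp: inf_absorb2)
  have hT: "h ` A \<subseteq> T"
    using h A by (auto simp: continuous_map_def)
  have "continuous_map (subtopology Z M) (subtopology Z A) g"
    using g M A by (auto simp: continuous_map_in_subtopology)
  then have "continuous_map (subtopology Z M) (top_of_set T) (h \<circ> g)"
    using h by (rule continuous_map_compose)
  then have 1: "continuous_map (subtopology Z M) euclideanreal (h \<circ> g)"
    by (simp add: continuous_map_in_subtopology)
  have 2: "(h \<circ> g) ` M \<subseteq> T"
    using g(2) hT by auto
  have 3: "T \<noteq> {}"
    using M hT by auto
  have 4: "closedin Z M"
    using M Z by (simp add: compactin_imp_closedin metrizable_imp_Hausdorff_space)
  obtain G where G: "continuous_map Z euclideanreal G" "G ` topspace Z \<subseteq> T"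
    and Gg: "\<And>x. x \<in> M \<Longrightarrow> G x = (h \<circ> g) x"
    using Tietze_extension_realinterval[OF metrizable_imp_normal_space[OF Z] 4 T 3 1 2] by blast
  show thesis
  proof
    have "continuous_map Z (top_of_set T) G"
      using G by (simp add: continuous_map_in_subtopology image_subset_iff_funcset)
    then show "continuous_map Z (subtopology Z A) (k \<circ> G)"
      using k by (rule continuous_map_compose)
    show "(k \<circ> G) x = g x" if "x \<in> M" for x
      using Gg[OF that] kh g(2) that by auto
  qed
qed

text \<open>Minimality of \<open>M\<close> depends only on the values of the map on
  \<open>M\<close>. Hence for both inclusions it suffices to replace \<open>f\<close> by an
  extension of its restriction to \<open>M\<close> with all values in \<open>A\<close>.\<close>

lemma minimal_sets_interval_subspace:
  fixes T :: "real set"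
  assumes Z: "metrizable_space Z" and A: "A \<subseteq> topspace Z"
    and hom: "subtopology Z A homeomorphic_space top_of_set T" and T: "is_interval T"
  shows "minimal_sets (subtopology Z A) = {M \<in> minimal_sets Z. M \<subseteq> A}"
proof -
  \<comment> \<open>\<open>W\<close> is the space on which the extension is built, \<open>W'\<close>
    the one in which \<open>M\<close> is to be a minimal set. Both times \<open>W\<close> is
    \<open>Z\<close>, while \<open>W'\<close> is first \<open>Z\<close> and then its subspace
    \<open>A\<close>.\<close>
  have transfer: "M \<in> minimal_sets W'"
    if W: "metrizable_space W" "A \<subseteq> topspace W"
        "subtopology W A homeomorphic_space top_of_set T"
      and M: "M \<noteq> {}" "compactin W M" "M \<subseteq> A" "f ` M = M" "continuous_map (subtopology W M) W f"
        "minimal_map (subtopology W M) f"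
      and W': "compactin W' M" "subtopology W M = subtopology W' M"
        "\<And>F. continuous_map W (subtopology W A) F \<Longrightarrow> continuous_map W' W' F"
    for W W' M f
  proof -
    obtain F where F: "continuous_map W (subtopology W A) F" "\<And>x. x \<in> M \<Longrightarrow> F x = f x"
      using extend_map_into_interval[OF W T M(2,3,1,5)] M(3,4) by auto
    have "minimal_map (subtopology W M) F"
      using M(6) minimal_map_cong[of "subtopology W M" f F] F(2) by simp
    moreover have "F ` M = M"
      using F(2) M(4) by (metis image_cong)
    ultimately show ?thesis
      unfolding minimal_sets_def using M(1) W' F(1) by auto
  qed
  have sub: "subtopology (subtopology Z A) M = subtopology Z M" if "M \<subseteq> A" for M
    using that by (simp add: subtopology_subtopology inf.absorb2)
  show ?thesis
  proof (intro equalityI subsetI)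
    fix M assume "M \<in> minimal_sets (subtopology Z A)"
    then obtain f where M: "M \<noteq> {}" "compactin (subtopology Z A) M" "f ` M = M"
      and f: "continuous_map (subtopology Z A) (subtopology Z A) f"
        "minimal_map (subtopology (subtopology Z A) M) f"
      unfolding minimal_sets_def by blast
    have MA: "M \<subseteq> A" "compactin Z M"
      using M(2) by (auto simp: compactin_subtopology)
    have c: "continuous_map (subtopology Z M) Z f"
      using f(1) MA
      by (metis continuous_map_from_subtopology_mono continuous_map_in_subtopology)
    have "M \<in> minimal_sets Z"
      by (rule transfer[OF Z A hom M(1) MA(2,1) M(3) c f(2)[unfolded sub[OF MA(1)]] MA(2) refl])
        (simp add: continuous_map_in_subtopology)
    then show "M \<in> {M \<in> minimal_sets Z. M \<subseteq> A}"
      using MA by blast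
  next
    fix M assume "M \<in> {M \<in> minimal_sets Z. M \<subseteq> A}"
    then obtain f where M: "M \<noteq> {}" "compactin Z M" "f ` M = M" and MA: "M \<subseteq> A"
      and f: "continuous_map Z Z f" "minimal_map (subtopology Z M) f"
      unfolding minimal_sets_def by blast
    have c: "continuous_map (subtopology Z M) Z f"
      using f(1) by (rule continuous_map_from_subtopology)
    have "compactin (subtopology Z A) M"
      using M(2) MA by (simp add: compactin_subtopology)
    then show "M \<in> minimal_sets (subtopology Z A)"
      by (rule transfer[OF Z A hom M(1,2) MA M(3) c f(2) _ sub[OF MA, symmetric]])
        (rule continuous_map_from_subtopology)
  qed
qed

section \<open>The wave\<close>

lemma tanh_artanh_real:
  fixes x :: real
  assumes "\<bar>x\<bar> < 1"
  shows "tanh (artanh x) = x"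
proof -
  have "0 < (1 + x) / (1 - x)"
    using assms by (auto simp: abs_if split: if_splits)
  then have "exp (- 2 * artanh x) = (1 - x) / (1 + x)"
    using assms by (simp add: artanh_def exp_minus inverse_eq_divide)
  then have "tanh (artanh x) = (1 - (1 - x) / (1 + x)) / (1 + (1 - x) / (1 + x))"
    by (simp add: tanh_real_altdef)
  also have "\<dots> = x"
    using assms by (simp add: field_simps abs_less_iff)
  finally show ?thesis .
qed

text \<open>Mean value estimate. Together with the one for sine it makes \<open>curve\<close>
  Lipschitz with constant 2 at nonnegative times, which turns distances in the plane into lengths of
  time in \<open>no_side_swap\<close>.\<close>

lemma abs_tanh_diff_le: "\<bar>tanh x - tanh y\<bar> \<le> \<bar>x - y\<bar>" for x y :: real
proof -
  have "norm (1 - (tanh z)\<^sup>2) \<le> 1" for z :: real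
    using tanh_real_bounds[of z] by (simp add: abs_square_le_1 abs_le_iff)
  then have "norm (tanh x - tanh y) \<le> 1 * norm (x - y)"
    by (intro field_differentiable_bound[of UNIV tanh "\<lambda>z. 1 - (tanh z)\<^sup>2"])
      (auto intro!: derivative_eq_intros)
  then show ?thesis by simp
qed

lemma abs_sin_diff_le: "\<bar>sin x - sin y\<bar> \<le> \<bar>x - y\<bar>" for x y :: real
proof -
  have "norm (sin x - sin y) \<le> 1 * norm (x - y)"
    by (intro field_differentiable_bound[of UNIV sin cos]) (auto intro!: derivative_eq_intros)
  then show ?thesis by simp
qed

text \<open>Since the square root varies ever more slowly, the amplitude equals 1, and equals 1/2, on
  arbitrarily long intervals arbitrarily far out.\<close>

definition amplitude :: "real \<Rightarrow> real" where
  "amplitude v = max (1/2) (min 1 (1 + sin (sqrt v)))"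

text \<open>At every \<open>t\<close> at least one summand vanishes because
  \<open>sin 0 = 0\<close>. Writing the two branches as a sum lets continuity follow by composition,
  without gluing at 0.\<close>

definition wave :: "real \<Rightarrow> real" where
  "wave t = sin (max t 0) + sin (max (- t) 0) * amplitude (max (- t) 0)"

lemma wave_nonneg: "0 \<le> t \<Longrightarrow> wave t = sin t"
  by (simp add: wave_def max_def)

lemma wave_uminus: "0 \<le> t \<Longrightarrow> wave (- t) = sin t * amplitude t"
  by (simp add: wave_def max_def)

lemma continuous_on_wave: "continuous_on A wave"
  unfolding wave_def amplitude_def by (intro continuous_intros)

lemma abs_wave_le: "\<bar>wave t\<bar> \<le> 1"
proof (cases "0 \<le> t")
  case True
  then show ?thesis by (simp add: wave_nonneg)
next
  case False
  have "\<bar>sin (- t)\<bar> * \<bar>amplitude (- t)\<bar> \<le> 1 * 1"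
    by (intro mult_mono) (auto simp: amplitude_def)
  then show ?thesis
    using wave_uminus[of "- t"] False by (simp add: abs_mult)
qed

section \<open>Long blocks of constant amplitude\<close>

lemma sqrt_slow:
  fixes a :: real
  assumes "0 \<le> a"
  obtains m :: nat and v where "B \<le> v" "0 \<le> v"
    "\<And>w. w \<in> {v..v + n} \<Longrightarrow> sqrt w - 2 * pi * real m \<in> {a..a + 1/2}"
proof -
  obtain m :: nat where m: "max (max B n) 1 \<le> real m"
    using real_arch_simple by blast
  \<comment> \<open>The square root needs the length \<open>c + 1/4\<close> to grow from
    \<open>c\<close> to \<open>c + 1/2\<close>, starting at the square of \<open>c\<close>. Since
    \<open>c\<close> is at least \<open>m\<close>, this length exceeds \<open>n\<close>, and the
    multiple of \<open>2 * pi\<close> is invisible to sine.\<close>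
  define c where "c = 2 * pi * real m + a"
  have c: "real m \<le> c"
    using mult_right_mono[of 1 "2 * pi" "real m"] assms pi_ge_two unfolding c_def by linarith
  show thesis
  proof (rule that[of "c\<^sup>2" m])
    have "1 * c \<le> c * c"
      using c m by (intro mult_right_mono) auto
    then show "B \<le> c\<^sup>2" "0 \<le> c\<^sup>2"
      using c m unfolding power2_eq_square by linarith+
    fix w assume w: "w \<in> {c\<^sup>2..c\<^sup>2 + n}"
    have "c \<le> sqrt w"
      using w c m by (intro real_le_rsqrt) auto
    moreover have "w \<le> (c + 1/2)\<^sup>2"
      using w c m by (simp add: power2_eq_square algebra_simps)
    then have "sqrt w \<le> c + 1/2"
      using c m by (intro real_le_lsqrt) auto
    ultimately show "sqrt w - 2 * pi * real m \<in> {a..a + 1/2}"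
      by (auto simp: c_def)
  qed
qed

lemma sin_minus_periods: "sin (x - 2 * pi * real m) = sin x"
  using sin_2npi[of m] cos_2npi[of m] by (simp add: sin_diff mult_ac)

text \<open>With \<open>a = 0\<close> the argument of the sine in \<open>amplitude\<close> stays,
  modulo periods, in \<open>{0..1/2}\<close>, where sine is nonnegative and the amplitude is cut off
  at 1.\<close>

lemma wave_full: "\<exists>v\<ge>B. \<forall>w\<in>{v..v + n}. wave (- w) = sin w"
proof -
  obtain m :: nat and v where v: "B \<le> v" "0 \<le> v"
    and w: "\<And>w. w \<in> {v..v + n} \<Longrightarrow> sqrt w - 2 * pi * real m \<in> {0..0 + 1/2}"
    using sqrt_slow[of 0] by blast
  have "wave (- w) = sin w" if w': "w \<in> {v..v + n}" for w
  proof -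
    have "0 \<le> sin (sqrt w - 2 * pi * real m)"
      using w[OF w'] pi_ge_two by (intro sin_ge_zero) auto
    then show ?thesis
      using w' v by (simp add: sin_minus_periods wave_uminus amplitude_def)
  qed
  with v show ?thesis by blast
qed

lemma wave_half: "\<exists>v\<ge>B. \<forall>w\<in>{v..v + n}. wave (- w) = sin w / 2"
proof -
  obtain m :: nat and v where v: "B \<le> v" "0 \<le> v"
    \<comment> \<open>Sine is at most -1/2 between \<open>7/6*pi\<close> and \<open>11/6*pi\<close>,
      an interval longer than 1/2; there the amplitude is cut off at 1/2.\<close>
    and w: "\<And>w. w \<in> {v..v + n} \<Longrightarrow> sqrt w - 2 * pi * real m \<in> {7/6*pi..7/6*pi + 1/2}"
    by (rule sqrt_slow[of "7/6*pi"]) (use pi_ge_two in auto)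
  have "wave (- w) = sin w / 2" if w': "w \<in> {v..v + n}" for w
  proof -
    \<comment> \<open>Centring at the minimum of sine replaces the bound on sine by a bound on
      cosine at distance at most \<open>pi/3\<close> from 0.\<close>
    let ?x = "sqrt w - 2 * pi * real m - 3/2*pi"
    have "cos (pi/3) \<le> cos \<bar>?x\<bar>"
      using w[OF w'] pi_ge_two by (intro cos_monotone_0_pi_le) (auto simp: abs_le_iff field_simps)
    then have "1/2 \<le> cos ?x"
      by (simp add: cos_60)
    moreover have "cos (y - 3/2*pi) = - sin y" for y :: real
      unfolding cos_diff cos_3over2_pi sin_3over2_pi by simp
    then have "cos ?x = - sin (sqrt w)"
      by (simp only: sin_minus_periods)
    ultimately show ?thesis
      using w' v by (simp add: wave_uminus amplitude_def)
  qed
  with v show ?thesis by blast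
qed

section \<open>The continuum\<close>

definition curve :: "real \<Rightarrow> real \<times> real" where
  "curve t = (tanh t, wave t)"

definition side :: "real \<Rightarrow> (real \<times> real) set" where
  "side \<sigma> = {\<sigma>} \<times> {-1..1}"

definition carrier :: "(real \<times> real) set" where
  "carrier = side 1 \<union> range curve \<union> side (-1)"

lemma fst_curve [simp]: "fst (curve t) = tanh t" and snd_curve [simp]: "snd (curve t) = wave t"
  by (simp_all add: curve_def)

lemma mem_side: "z \<in> side \<sigma> \<longleftrightarrow> fst z = \<sigma> \<and> \<bar>snd z\<bar> \<le> 1"
  by (cases z) (auto simp: side_def)

lemma mem_range_curve: "z \<in> range curve \<longleftrightarrow> \<bar>fst z\<bar> < 1 \<and> snd z = wave (artanh (fst z))"
proof
  assume "z \<in> range curve"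
  then show "\<bar>fst z\<bar> < 1 \<and> snd z = wave (artanh (fst z))"
    using tanh_real_bounds by (auto simp: artanh_tanh_real abs_less_iff minus_less_iff)
next
  assume "\<bar>fst z\<bar> < 1 \<and> snd z = wave (artanh (fst z))"
  then have "z = curve (artanh (fst z))"
    by (simp add: prod_eq_iff tanh_artanh_real)
  then show "z \<in> range curve"
    by (rule range_eqI)
qed

lemma curve_in_carrier [simp]: "curve t \<in> carrier"
  by (simp add: carrier_def)

lemma mem_carrier:
  "z \<in> carrier \<longleftrightarrow>
    \<bar>fst z\<bar> \<le> 1 \<and> \<bar>snd z\<bar> \<le> 1 \<and> (\<bar>fst z\<bar> < 1 \<longrightarrow> snd z = wave (artanh (fst z)))"
proof -
  have "z \<in> carrier \<longleftrightarrow> z \<in> side 1 \<or> z \<in> range curve \<or> z \<in> side (-1)"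
    unfolding carrier_def by blast
  moreover have "\<bar>fst z\<bar> \<le> 1 \<longleftrightarrow> \<bar>fst z\<bar> < 1 \<or> fst z = 1 \<or> fst z = - 1"
    by linarith
  ultimately show ?thesis
    unfolding mem_side mem_range_curve using abs_wave_le by force
qed

lemma mem_side_iff_fst:
  assumes "z \<in> carrier" "\<bar>\<sigma>\<bar> = 1"
  shows "z \<in> side \<sigma> \<longleftrightarrow> fst z = \<sigma>"
  using assms unfolding mem_carrier mem_side by auto

lemma mem_range_curve_iff_fst:
  assumes "z \<in> carrier"
  shows "z \<in> range curve \<longleftrightarrow> \<bar>fst z\<bar> < 1"
  using assms unfolding mem_carrier mem_range_curve by auto

lemma side_disjnt_range_curve: "\<bar>\<sigma>\<bar> = 1 \<Longrightarrow> disjnt (side \<sigma>) (range curve)"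
  unfolding disjnt_iff mem_side mem_range_curve by auto

lemma continuous_on_curve: "continuous_on A curve"
  unfolding curve_def[abs_def] by (intro continuous_intros continuous_on_wave) auto

lemma continuous_on_artanh_comp:
  fixes f :: "'a::topological_space \<Rightarrow> real"
  assumes "continuous_on A f" "\<And>x. x \<in> A \<Longrightarrow> \<bar>f x\<bar> < 1"
  shows "continuous_on A (\<lambda>x. artanh (f x))"
  by (rule continuous_on_compose2[OF continuous_on_artanh assms(1) order.refl])
    (use assms(2) in \<open>auto simp: abs_less_iff minus_less_iff\<close>)

lemma continuous_on_artanh_fst: "continuous_on (range curve) (\<lambda>z. artanh (fst z))"
  by (intro continuous_on_artanh_comp continuous_intros) (simp add: mem_range_curve)

lemma homeomorphism_curve: "homeomorphism UNIV (range curve) curve (\<lambda>z. artanh (fst z))"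
  by (rule homeomorphismI)
    (auto simp: artanh_tanh_real continuous_on_curve continuous_on_artanh_fst)

text \<open>Inside the square, the points missing from \<open>carrier\<close> are those of the open
  strip that lie off the graph. They form an open set because the graph is the zero set of a
  function continuous on the strip.\<close>

lemma compact_carrier: "compact carrier"
proof -
  let ?S = "{z::real \<times> real. \<bar>fst z\<bar> < 1}"
  let ?g = "\<lambda>z. snd z - wave (artanh (fst z))"
  have eq: "carrier = cbox (-1, -1) (1, 1) - {z \<in> ?S. ?g z \<noteq> 0}"
    by (rule set_eqI) (auto simp: mem_carrier mem_box Basis_prod_def abs_le_iff)
  have "open ?S"
    by (intro open_Collect_less continuous_intros)
  moreover have "continuous_on ?S ?g"
    by (intro continuous_on_artanh_comp continuous_intros
        continuous_on_compose2[OF continuous_on_wave[of UNIV]]) auto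
  ultimately have "open (?S \<inter> ?g -` (- {0}))"
    by (intro continuous_open_preimage) auto
  also have "?S \<inter> ?g -` (- {0}) = {z \<in> ?S. ?g z \<noteq> 0}"
    by blast
  finally show ?thesis
    unfolding eq by (intro compact_diff compact_cbox)
qed

section \<open>Recurrence of heights and density of the curve\<close>

lemma wave_recurrent:
  assumes "\<bar>\<sigma>\<bar> = 1" "\<bar>y\<bar> \<le> 1"
  shows "\<exists>t\<ge>B. wave (\<sigma> * t) = y"
proof -
  have "\<exists>v\<ge>max B 0. \<forall>w\<in>{v..v + 4 * pi}. wave (\<sigma> * w) = sin w"
  proof (cases "\<sigma> = 1")
    case True
    then show ?thesis by (intro exI[of _ "max B 0"]) (auto simp: wave_nonneg)
  next
    case False
    then have "\<sigma> = - 1" using assms by auto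
    then show ?thesis using wave_full[of "max B 0" "4 * pi"] by auto
  qed
  then obtain v where v: "v \<ge> max B 0" "\<forall>w\<in>{v..v + 4 * pi}. wave (\<sigma> * w) = sin w"
    by blast
  \<comment> \<open>The least \<open>m\<close> with \<open>2 * pi * m\<close> at least
    \<open>v + pi\<close>. As the arcsine is at most \<open>pi/2\<close> in absolute value,
    \<open>w\<close> then lies between \<open>v + pi/2\<close> and \<open>v + 7/2*pi\<close>, inside
    the full block.\<close>
  define m where "m = nat \<lceil>(v + pi) / (2 * pi)\<rceil>"
  define w where "w = arcsin y + 2 * pi * real m"
  have "0 \<le> (v + pi) / (2 * pi)"
    using v by simp
  then have "(v + pi) / (2 * pi) \<le> real m" "real m < (v + pi) / (2 * pi) + 1"
    unfolding m_def by linarith+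
  then have "v + pi \<le> 2 * pi * real m" "2 * pi * real m < v + pi + 2 * pi"
    by (simp_all add: field_simps)
  moreover have "- (pi/2) \<le> arcsin y" "arcsin y \<le> pi/2"
    using assms arcsin_bounded[of y] by auto
  ultimately have "w \<in> {v..v + 4 * pi}"
    using pi_ge_two by (auto simp: w_def)
  moreover have "sin w = y"
    using assms sin_minus_periods[of w m] by (simp add: w_def abs_le_iff)
  ultimately show ?thesis
    using v by (intro exI[of _ w]) auto
qed

lemma tendsto_one_minus_tanh: "((\<lambda>t::real. 1 - tanh t) \<longlongrightarrow> 0) at_top"
  using tendsto_diff[OF tendsto_const tanh_real_at_top, of 1] by simp

lemma dist_curve_side:
  assumes "\<bar>\<sigma>\<bar> = 1"
  shows "dist (curve (\<sigma> * t)) (\<sigma>, wave (\<sigma> * t)) = 1 - tanh t"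
proof -
  have "\<sigma> = 1 \<or> \<sigma> = -1"
    using assms by auto
  then show ?thesis
    using tanh_real_lt_1[of t] by (auto simp: curve_def dist_prod_def dist_real_def)
qed

text \<open>By recurrence the curve takes the height of a given point of the side at arbitrarily
  late times, and then it is only \<open>1 - tanh t\<close> away. The bound \<open>B\<close> makes
  this hold for every tail, as needed for the rays and for \<open>no_side_swap\<close>.\<close>

lemma side_subset_closure:
  assumes "\<bar>\<sigma>\<bar> = 1"
  shows "side \<sigma> \<subseteq> closure (curve ` {t. B \<le> \<sigma> * t})"
proof
  fix z assume z: "z \<in> side \<sigma>"
  show "z \<in> closure (curve ` {t. B \<le> \<sigma> * t})"
    unfolding closure_approachable
  proof (intro allI impI)
    fix e :: real assume "0 < e"
    then have "\<forall>\<^sub>F t in at_top. 1 - tanh t < e"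
      using order_tendstoD(2)[OF tendsto_one_minus_tanh] by blast
    then obtain T :: real where T: "\<And>t. T \<le> t \<Longrightarrow> 1 - tanh t < e"
      by (auto simp: eventually_at_top_linorder)
    obtain t where t: "max T B \<le> t" "wave (\<sigma> * t) = snd z"
      using wave_recurrent[OF assms, of "snd z" "max T B"] z by (auto simp: mem_side)
    have "dist (curve (\<sigma> * t)) z < e"
      using dist_curve_side[OF assms, of t] T[of t] t z by (cases z) (simp add: mem_side)
    moreover have s: "\<sigma> * (\<sigma> * t) = t"
      using assms by (auto simp: abs_if split: if_splits)
    have "B \<le> \<sigma> * (\<sigma> * t)"
      using t(1) unfolding s by simp
    ultimately show "\<exists>y\<in>curve ` {t. B \<le> \<sigma> * t}. dist y z < e"
      by blast
  qed
qed

lemma carrier_subset_closure: "carrier \<subseteq> closure (range curve)"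
proof -
  have "side \<sigma> \<subseteq> closure (range curve)" if "\<bar>\<sigma>\<bar> = 1" for \<sigma>
    using side_subset_closure[OF that, of 0] closure_mono[of _ "range curve"] by blast
  from this[of 1] this[of "-1"] show ?thesis
    using closure_subset[of "range curve"] by (auto simp: carrier_def)
qed

lemma connected_carrier: "connected carrier"
proof (rule connected_intermediate_closure)
  show "connected (range curve)"
    by (intro connected_continuous_image continuous_on_curve) auto
qed (auto simp: carrier_subset_closure)

section \<open>Continuous self-maps\<close>

text \<open>The preimage of a side is clopen: a path close to a point of the side but not on it has to run
  through all of the infinitely many full waves near that side.\<close>

lemma side_absorbs_interval_image:
  fixes D :: "real set"
  assumes "\<bar>\<sigma>\<bar> = 1" and D: "is_interval D" and g: "continuous_on D g" "g ` D \<subseteq> carrier"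
    and "a \<in> D" "g a \<in> side \<sigma>"
  shows "g ` D \<subseteq> side \<sigma>"
proof -
  let ?A = "{t \<in> D. g t \<in> side \<sigma>}"
  have side: "g t \<in> side \<sigma> \<longleftrightarrow> fst (g t) = \<sigma>" if "t \<in> D" for t
    using g(2) that assms(1) by (intro mem_side_iff_fst) auto
  have "closedin (top_of_set D) (D \<inter> g -` side \<sigma>)"
    using g(1) by (intro continuous_closedin_preimage) (simp_all add: side_def closed_Times)
  then have closed: "closedin (top_of_set D) ?A"
    by (simp add: Int_def vimage_def)
  have "\<exists>e>0. \<forall>t'\<in>D. dist t' t < e \<longrightarrow> t' \<in> ?A" if "t \<in> ?A" for t
  proof -
    have t: "t \<in> D" "fst (g t) = \<sigma>"
      using that side by auto
    obtain e where e: "0 < e" and near: "\<And>u. u \<in> D \<Longrightarrow> dist u t < e \<Longrightarrow> dist (g u) (g t) < 1"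
      using g(1) t(1) unfolding continuous_on_iff by (metis zero_less_one)
    have "u \<in> ?A" if u: "u \<in> D" "dist u t < e" for u
    proof (rule ccontr)
      assume "u \<notin> ?A"
      then have ne: "fst (g u) \<noteq> \<sigma>"
        using side u(1) by blast
      have seg: "closed_segment u t \<subseteq> D"
        using D u(1) t(1) by (simp add: closed_segment_subset is_interval_convex)
      have near': "\<bar>snd (g w) - snd (g t)\<bar> < 1" if "w \<in> closed_segment u t" for w
      proof -
        have "dist w t \<le> dist u t"
          using segment_bound(2)[OF that] by (simp add: dist_norm)
        then have "dist (g w) (g t) < 1"
          using near that seg u(2) by force
        then show ?thesis
          using dist_snd_le[of "g w" "g t"] by (simp add: dist_real_def)
      qed
      have "\<bar>fst (g u)\<bar> \<le> 1"
        using g(2) u(1) by (auto simp: mem_carrier)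
      then have lt: "\<sigma> * fst (g u) < 1"
        using ne assms(1) by (auto simp: abs_if split: if_splits)
      obtain T :: real where T: "\<And>\<tau>. T \<le> \<tau> \<Longrightarrow> \<sigma> * fst (g u) < tanh \<tau>"
        using order_tendstoD(1)[OF tanh_real_at_top lt] by (auto simp: eventually_at_top_linorder)
      \<comment> \<open>Between \<open>u\<close> and \<open>t\<close> the first coordinate of
        \<open>g\<close> runs from \<open>fst (g u)\<close> to \<sigma>, so it meets the abscissa of
        a late point of the curve with height \<open>y\<close>. Over an abscissa strictly between -1
        and 1 the carrier has a single point.\<close>
      have hit: "\<exists>w\<in>closed_segment u t. snd (g w) = y" if y: "\<bar>y\<bar> \<le> 1" for y
      proof -
        obtain \<tau> where \<tau>: "T \<le> \<tau>" "wave (\<sigma> * \<tau>) = y"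
          using wave_recurrent[OF assms(1) y] by blast
        have "\<sigma> * tanh \<tau> = tanh (\<sigma> * \<tau>)"
          using assms(1) by (auto simp: abs_if split: if_splits)
        moreover have "\<sigma> * tanh \<tau> \<in> closed_segment (fst (g u)) (fst (g t))"
          using T[OF \<tau>(1)] tanh_real_lt_1[of \<tau>] t(2) assms(1)
          by (auto simp: closed_segment_eq_real_ivl abs_if split: if_splits)
        moreover have "continuous_on (closed_segment u t) (\<lambda>w. fst (g w))"
          using g(1) seg by (intro continuous_intros) (rule continuous_on_subset)
        ultimately obtain w where w: "w \<in> closed_segment u t" "fst (g w) = tanh (\<sigma> * \<tau>)"
          using IVT'_closed_segment_real[of _ "\<lambda>w. fst (g w)" u t] by metis
        have "g w \<in> carrier"
          using g(2) seg w(1) by blast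
        then have "snd (g w) = wave (\<sigma> * \<tau>)"
          using w(2) tanh_real_bounds[of "\<sigma> * \<tau>"]
          by (simp add: mem_carrier artanh_tanh_real abs_less_iff)
        with w(1) \<tau>(2) show ?thesis by blast
      qed
      \<comment> \<open>Heights 1 and -1 are 2 apart, yet both should differ from
        \<open>snd (g t)\<close> by less than 1.\<close>
      obtain v w where "v \<in> closed_segment u t" "snd (g v) = 1"
        "w \<in> closed_segment u t" "snd (g w) = - 1"
        using hit[of 1] hit[of "-1"] by auto
      then show False
        using near'[of v] near'[of w] by linarith
    qed
    with e show ?thesis by blast
  qed
  then have "openin (top_of_set D) ?A"
    unfolding openin_euclidean_subtopology_iff by auto
  then have "?A = {} \<or> ?A = D"
    using closed D is_interval_connected[of D] unfolding connected_clopen by blast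
  then show ?thesis
    using assms(5,6) by blast
qed

lemma interval_image_cases:
  fixes D :: "real set"
  assumes "is_interval D" "continuous_on D g" "g ` D \<subseteq> carrier"
  shows "g ` D \<subseteq> side 1 \<or> g ` D \<subseteq> range curve \<or> g ` D \<subseteq> side (-1)"
proof -
  have *: "g ` D \<subseteq> side \<sigma>" if "\<bar>\<sigma>\<bar> = 1" "a \<in> D" "g a \<in> side \<sigma>" for \<sigma> a
    using side_absorbs_interval_image[OF that(1) assms that(2,3)] .
  have "g a \<in> side 1 \<or> g a \<in> range curve \<or> g a \<in> side (-1)" if "a \<in> D" for a
    using assms(3) that unfolding carrier_def by blast
  then show ?thesis
    using *[of 1] *[of "-1"] by (metis abs_1 abs_minus image_subsetI)
qed

lemma side_eq_image: "side \<sigma> = Pair \<sigma> ` {-1..1}"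
  by (auto simp: side_def)

text \<open>Each of the three pieces is a continuous image of an interval, so the dichotomy for
  interval images applies to \<open>f\<close> composed with a parametrization.\<close>

lemma image_cases:
  assumes "continuous_on carrier f" "f ` carrier \<subseteq> carrier"
    and "S \<in> {side 1, range curve, side (-1)}"
  shows "f ` S \<subseteq> side 1 \<or> f ` S \<subseteq> range curve \<or> f ` S \<subseteq> side (-1)"
proof -
  have "\<exists>(D::real set) q. is_interval D \<and> continuous_on D q \<and> S = q ` D"
  proof (cases "S = range curve")
    case True
    then show ?thesis
      using continuous_on_curve is_interval_univ by blast
  next
    case False
    then obtain \<sigma> where "S = side \<sigma>"
      using assms(3) by blast
    moreover have "continuous_on {-1..1} (Pair \<sigma>)"
      by (intro continuous_intros)
    ultimately show ?thesis
      using side_eq_image is_interval_cc by blast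
  qed
  then obtain D :: "real set" and q where q: "is_interval D" "continuous_on D q" "S = q ` D"
    by blast
  have "S \<subseteq> carrier"
    using assms(3) by (auto simp: carrier_def)
  then have sub: "q ` D \<subseteq> carrier"
    using q(3) by simp
  have "continuous_on D (f \<circ> q)"
    using continuous_on_compose[OF q(2) continuous_on_subset[OF assms(1) sub]] .
  moreover have "(f \<circ> q) ` D \<subseteq> carrier"
    using sub assms(2) by auto
  ultimately show ?thesis
    using interval_image_cases[OF q(1), of "f \<circ> q"] unfolding q(3) image_comp by blast
qed

text \<open>Seen in the parameter of the curve, \<open>f\<close> becomes a map \<open>s\<close> of the line tending to minus infinity
  at plus infinity. Some \<open>y\<close> on the right side goes to the top \<open>(-1, 1)\<close> of the left side; at the times
  \<open>\<tau> j\<close>, spaced by \<open>2 * pi\<close>, the curve is at the height of \<open>y\<close>, hence eventually its image has height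
  above 1/2 and \<open>s (\<tau> j)\<close> avoids every block of half-amplitude waves. So some step from \<open>\<tau> j\<close> to
  \<open>\<tau> (Suc j)\<close> jumps over a block with \<open>n\<close> extrema. By uniform continuity each extremum costs time at
  least \<open>d\<close>, which is absurd when \<open>n * d > 2 * pi\<close>.\<close>

lemma no_side_swap:
  assumes f: "continuous_on carrier f" "f ` carrier \<subseteq> carrier"
    and core: "f ` range curve \<subseteq> range curve"
    and right: "f ` side 1 \<subseteq> side (-1)" and left: "f ` side (-1) \<subseteq> side 1"
  shows False
proof -
  define s where "s t = artanh (fst (f (curve t)))" for t
  have curve_s: "curve (s t) = f (curve t)" for t
  proof -
    have "f (curve t) \<in> range curve"
      using core by blast
    then show ?thesis
      unfolding s_def by (auto simp: artanh_tanh_real)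
  qed
  have "continuous_on UNIV (\<lambda>t. f (curve t))"
    by (rule continuous_on_compose2[OF f(1) continuous_on_curve]) auto
  then have "continuous_on UNIV s"
    unfolding s_def
    by (rule continuous_on_compose2[OF continuous_on_artanh_fst]) (use core in auto)
  then have cont_s: "continuous_on A s" for A
    by (rule continuous_on_subset) simp
  have unif: "\<exists>d>0. \<forall>z\<in>carrier. \<forall>z'\<in>carrier. dist z' z < d \<longrightarrow> dist (f z') (f z) < e"
    if "0 < e" for e
    using compact_uniformly_continuous[OF f(1) compact_carrier] that
    unfolding uniformly_continuous_on_def by blast

  \<comment> \<open>At late times the curve is close to the point of \<open>side 1\<close> at the
    same height, which \<open>f\<close> sends to abscissa -1. The tolerance
    \<open>1 + tanh B\<close> is the horizontal gap between that abscissa and parameter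
    \<open>B\<close>.\<close>
  have to_bot: "\<exists>T. \<forall>t\<ge>T. s t < B" for B
  proof -
    have "0 < 1 + tanh B"
      using tanh_real_gt_neg1[of B] by simp
    then obtain d where d: "0 < d" "\<And>z z'. z \<in> carrier \<Longrightarrow> z' \<in> carrier \<Longrightarrow> dist z' z < d \<Longrightarrow>
        dist (f z') (f z) < 1 + tanh B"
      using unif by metis
    obtain T :: real where T: "\<And>t. T \<le> t \<Longrightarrow> 1 - tanh t < d"
      using order_tendstoD(2)[OF tendsto_one_minus_tanh d(1)]
      by (auto simp: eventually_at_top_linorder)
    have "s t < B" if "T \<le> t" for t
    proof -
      let ?z = "(1, wave t)"
      have z: "?z \<in> side 1"
        by (simp add: mem_side abs_wave_le)
      then have "fst (f ?z) = - 1"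
        using right by (auto simp: mem_side image_subset_iff)
      moreover have "?z \<in> carrier"
        using z by (simp add: carrier_def)
      then have "dist (f (curve t)) (f ?z) < 1 + tanh B"
        using d(2)[of ?z "curve t"] dist_curve_side[of 1 t] T[OF that] by simp
      then have "\<bar>fst (f (curve t)) - fst (f ?z)\<bar> < 1 + tanh B"
        using dist_fst_le[of "f (curve t)" "f ?z"] by (simp add: dist_real_def)
      ultimately have "\<bar>tanh (s t) + 1\<bar> < 1 + tanh B"
        by (simp flip: curve_s)
      then have "tanh (s t) < tanh B"
        by linarith
      then show ?thesis
        by simp
    qed
    then show ?thesis by blast
  qed

  \<comment> \<open>By the intermediate value theorem \<open>s\<close> takes every value up to
    \<open>s 0\<close>, so the compact image of \<open>f\<close> contains a left tail of the curve
    and with it \<open>side (-1)\<close>. A preimage of the top point can only lie on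
    \<open>side 1\<close>, since \<open>f\<close> sends the other two pieces elsewhere.\<close>
  obtain y where y: "y \<in> side 1" "f y = (-1, 1)"
  proof -
    have range_s: "\<exists>t. s t = b" if b: "b \<le> s 0" for b
    proof -
      obtain T where T: "\<And>t. T \<le> t \<Longrightarrow> s t < b"
        using to_bot by blast
      obtain t1 where t1: "0 \<le> t1" "s t1 < b"
        using T[of "max T 0"] by (metis max.cobounded1 max.cobounded2)
      have "\<exists>t. 0 \<le> t \<and> t \<le> t1 \<and> s t = b"
        by (rule IVT2') (use b t1 cont_s in auto)
      then show ?thesis by blast
    qed
    have "curve ` {t. - s 0 \<le> (-1) * t} \<subseteq> f ` carrier"
    proof (rule image_subsetI)
      fix b assume "b \<in> {t. - s 0 \<le> (-1) * t}"
      then obtain t where "s t = b"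
        using range_s by auto
      then show "curve b \<in> f ` carrier"
        using curve_s[of t] by auto
    qed
    moreover have "closed (f ` carrier)"
      using compact_continuous_image[OF f(1) compact_carrier] by (rule compact_imp_closed)
    ultimately have "closure (curve ` {t. - s 0 \<le> (-1) * t}) \<subseteq> f ` carrier"
      by (rule closure_minimal)
    moreover have "\<bar>- 1 :: real\<bar> = 1"
      by simp
    ultimately have "side (-1) \<subseteq> f ` carrier"
      using side_subset_closure by (meson order_trans)
    then have "(-1, 1) \<in> f ` carrier"
      by (auto simp: side_def)
    then obtain z where z: "z \<in> carrier" "f z = (-1, 1)"
      by force
    then have "f z \<notin> range curve" "f z \<notin> side 1"
      unfolding mem_range_curve mem_side by simp_all
    then have "z \<notin> range curve" "z \<notin> side (-1)"
      using core left by blast+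
    then have "z \<in> side 1"
      using z(1) by (auto simp: carrier_def)
    with that z(2) show thesis by blast
  qed

  define \<tau> where "\<tau> j = arcsin (snd y) + 2 * pi * real j" for j :: nat
  have \<tau>_ge: "2 * pi * real j - pi/2 \<le> \<tau> j" for j
    using arcsin_bounded[of "snd y"] y(1) by (simp add: \<tau>_def mem_side abs_le_iff)
  have wave_\<tau>: "wave (\<tau> j) = snd y" if "1 \<le> j" for j
  proof -
    have "2 * pi * 1 \<le> 2 * pi * real j"
      using that by (intro mult_left_mono) auto
    then have "0 \<le> \<tau> j"
      using \<tau>_ge[of j] pi_ge_two by linarith
    moreover have "sin (\<tau> j) = snd y"
      using sin_minus_periods[of "\<tau> j" j] y(1) by (simp add: \<tau>_def mem_side abs_le_iff)
    ultimately show ?thesis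
      by (simp add: wave_nonneg)
  qed

  obtain T where T: "0 \<le> T" "\<And>j. T \<le> \<tau> j \<Longrightarrow> 1 \<le> j \<Longrightarrow> 1/2 < wave (s (\<tau> j))"
  proof -
    obtain d where d: "0 < d" "\<And>z z'. z \<in> carrier \<Longrightarrow> z' \<in> carrier \<Longrightarrow> dist z' z < d \<Longrightarrow>
        dist (f z') (f z) < 1/2"
      using unif[of "1/2"] by auto
    obtain T where T: "\<And>t. T \<le> t \<Longrightarrow> 1 - tanh t < d"
      using order_tendstoD(2)[OF tendsto_one_minus_tanh d(1)]
      by (auto simp: eventually_at_top_linorder)
    show thesis
    proof (rule that[of "max T 0"])
      fix j assume j: "max T 0 \<le> \<tau> j" "1 \<le> j"
      have eq: "(1, wave (\<tau> j)) = y"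
        using y(1) wave_\<tau>[OF j(2)] by (simp add: mem_side prod_eq_iff)
      have "dist (curve (\<tau> j)) y < d"
        using dist_curve_side[of 1 "\<tau> j"] T[of "\<tau> j"] j unfolding eq[symmetric] by simp
      moreover have "y \<in> carrier"
        using y(1) by (simp add: carrier_def)
      ultimately have "dist (curve (s (\<tau> j))) (-1, 1) < 1/2"
        using d(2)[of y "curve (\<tau> j)"] y(2) curve_s by simp
      then have "\<bar>wave (s (\<tau> j)) - 1\<bar> < 1/2"
        using dist_snd_le[of "curve (s (\<tau> j))" "(-1, 1)"] by (simp add: dist_real_def)
      then show "1/2 < wave (s (\<tau> j))"
        by linarith
    qed simp
  qed

  \<comment> \<open>Within time less than \<open>d\<close> the height of the image changes by less
    than 1. The halving below compensates the Lipschitz constant 2 of \<open>curve\<close>.\<close>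
  obtain d where d: "0 < d"
    "\<And>t t'. 0 \<le> t \<Longrightarrow> 0 \<le> t' \<Longrightarrow> \<bar>t' - t\<bar> < d \<Longrightarrow> \<bar>wave (s t') - wave (s t)\<bar> < 1"
  proof -
    obtain d where d: "0 < d" "\<And>z z'. z \<in> carrier \<Longrightarrow> z' \<in> carrier \<Longrightarrow> dist z' z < d \<Longrightarrow>
        dist (f z') (f z) < 1"
      using unif[of 1] by auto
    show thesis
    proof (rule that[of "d/2"])
      fix t t' :: real assume t: "0 \<le> t" "0 \<le> t'" "\<bar>t' - t\<bar> < d/2"
      have "dist (curve t') (curve t) \<le> \<bar>tanh t' - tanh t\<bar> + \<bar>sin t' - sin t\<bar>"
        using t sqrt_sum_squares_le_sum_abs[of "tanh t' - tanh t" "sin t' - sin t"]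
        by (simp add: dist_prod_def dist_real_def wave_nonneg)
      also have "\<dots> < d"
        using abs_tanh_diff_le[of t' t] abs_sin_diff_le[of t' t] t(3) by linarith
      finally have "dist (curve (s t')) (curve (s t)) < 1"
        using d(2) curve_s by simp
      then show "\<bar>wave (s t') - wave (s t)\<bar> < 1"
        using dist_snd_le[of "curve (s t')" "curve (s t)"] by (simp add: dist_real_def)
    qed (use d in simp)
  qed

  obtain j0 :: nat where j0: "T + pi \<le> 2 * pi * real j0" "1 \<le> j0"
  proof -
    obtain j :: nat where "max ((T + pi) / (2 * pi)) 1 \<le> real j"
      using real_arch_simple by blast
    then show thesis
      using that[of j] by (simp add: field_simps)
  qed
  have large: "T \<le> \<tau> j" "1 \<le> j" if "j0 \<le> j" for j
  proof -
    have "2 * pi * real j0 \<le> 2 * pi * real j"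
      using that by (intro mult_left_mono) auto
    then show "T \<le> \<tau> j"
      using j0(1) \<tau>_ge[of j] pi_gt_zero by linarith
  qed (use that j0 in simp)

  obtain n :: nat where n: "2 * pi < real n * d"
    using reals_Archimedean3[OF d(1)] by blast
  \<comment> \<open>The half-amplitude block starts beyond \<open>- s (\<tau> j0)\<close>, so the
    image begins on its right. The slack of \<open>2 * pi\<close> in its length leaves room for the
    extrema \<open>w 0\<close> to \<open>w n\<close> after rounding \<open>v\<close> up to a
    multiple of \<open>pi\<close>.\<close>
  obtain v where v: "max 0 (- s (\<tau> j0)) + 1 \<le> v"
    and half: "\<And>w. w \<in> {v..v + pi * (real n + 2)} \<Longrightarrow> wave (- w) = sin w / 2"
    using wave_half by blast
  define N where "N = nat \<lceil>v / pi\<rceil>"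
  define w where "w i = pi/2 + pi * real (N + i)" for i
  have "v / pi \<le> real N" "real N < v / pi + 1"
    using v unfolding N_def by (simp_all add: le_nat_floor) linarith+
  then have N: "v \<le> pi * real N" "pi * real N < v + pi"
    by (simp_all add: field_simps)
  have w_mono: "w i \<le> w i'" if "i \<le> i'" for i i'
    using that by (simp add: w_def)
  have w_bounds: "v \<le> w 0" "w n \<le> v + pi * (real n + 2)"
    using N pi_gt_zero by (simp_all add: w_def algebra_simps)
  \<comment> \<open>Consecutive extrema have heights 1/2 and -1/2 in some order, so their difference
    is exactly the threshold in the choice of \<open>d\<close>.\<close>
  have jump: "\<bar>wave (- w (Suc i)) - wave (- w i)\<bar> = 1" if "Suc i \<le> n" for i
  proof -
    have "w (Suc i) = w i + pi"
      by (simp add: w_def algebra_simps)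
    then have "sin (w (Suc i)) = - sin (w i)"
      by simp
    moreover have "\<bar>sin (w i)\<bar> = 1"
      by (simp add: w_def sin_add power_abs del: of_nat_add)
    moreover have "w k \<in> {v..v + pi * (real n + 2)}" if "k \<le> n" for k
      using w_bounds w_mono[of 0 k] w_mono[of k n] that by auto
    then have "wave (- w k) = sin (w k) / 2" if "k \<le> n" for k
      using half that by blast
    then have "wave (- w (Suc i)) = sin (w (Suc i)) / 2" "wave (- w i) = sin (w i) / 2"
      using that by simp_all
    ultimately show ?thesis
      by (auto simp: abs_if split: if_splits)
  qed

  \<comment> \<open>Moving left across the block, \<open>s\<close> meets the parameters of the
    extrema in order, and by \<open>jump\<close> each passage to the next takes time at least
    \<open>d\<close>.\<close>
  have crossing: "\<exists>t\<in>{a..b}. s t = - w i \<and> real i * d \<le> t - a"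
    if "0 \<le> a" "a \<le> b" "- w 0 \<le> s a" "s b \<le> - w n" "i \<le> n" for a b i
    using that(5)
  proof (induction i)
    case 0
    have "\<exists>t. a \<le> t \<and> t \<le> b \<and> s t = - w 0"
      by (rule IVT2') (use that w_mono[of 0 n] cont_s in auto)
    then show ?case by auto
  next
    case (Suc i)
    then obtain t where t: "t \<in> {a..b}" "s t = - w i" "real i * d \<le> t - a"
      by auto
    have "\<exists>u. t \<le> u \<and> u \<le> b \<and> s u = - w (Suc i)"
      by (rule IVT2') (use that t Suc.prems w_mono[of "Suc i" n] w_mono[of i "Suc i"] cont_s in auto)
    then obtain u where u: "t \<le> u" "u \<le> b" "s u = - w (Suc i)"
      by blast
    have "\<not> \<bar>u - t\<bar> < d"
      using d(2)[of t u] jump[OF Suc.prems] t u that(1) by auto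
    then show ?case
      using t u by (intro bexI[of _ u]) (auto simp: algebra_simps)
  qed

  \<comment> \<open>The image stays on the right of the block at all times \<open>\<tau> j\<close>:
    it cannot be inside, where heights are at most 1/2, and passing over it in one step would take
    time \<open>n * d\<close>, more than \<open>2 * pi\<close>. This contradicts
    \<open>to_bot\<close>.\<close>
  have "- w 0 \<le> s (\<tau> j)" if "j0 \<le> j" for j
    using that
  proof (induction j rule: dec_induct)
    case base
    then show ?case
      using v w_bounds(1) by linarith
  next
    case (step j)
    show ?case
    proof (rule ccontr)
      assume low: "\<not> - w 0 \<le> s (\<tau> (Suc j))"
      have "\<not> - w n \<le> s (\<tau> (Suc j))"
      proof
        assume "- w n \<le> s (\<tau> (Suc j))"
        then have "wave (- (- s (\<tau> (Suc j)))) = sin (- s (\<tau> (Suc j))) / 2"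
          using low w_bounds by (intro half) auto
        then have "wave (s (\<tau> (Suc j))) \<le> 1/2"
          using sin_le_one[of "- s (\<tau> (Suc j))"] by simp
        then show False
          using T(2)[of "Suc j"] large[of "Suc j"] step.hyps by simp
      qed
      then obtain t where "t \<in> {\<tau> j..\<tau> (Suc j)}" "real n * d \<le> t - \<tau> j"
        using crossing[of "\<tau> j" "\<tau> (Suc j)" n] step T(1) large(1)[of j]
        by (force simp: \<tau>_def)
      moreover have "\<tau> (Suc j) - \<tau> j = 2 * pi"
        by (simp add: \<tau>_def algebra_simps)
      ultimately show False
        using n by auto
    qed
  qed
  note above = this
  obtain T' where T': "\<And>t. T' \<le> t \<Longrightarrow> s t < - w 0"
    using to_bot by blast
  obtain k :: nat where "max ((T' + pi) / (2 * pi)) (real j0) \<le> real k"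
    using real_arch_simple by blast
  then have k: "T' + pi \<le> 2 * pi * real k" "j0 \<le> k"
    by (simp_all add: field_simps)
  then have "T' \<le> \<tau> k"
    using \<tau>_ge[of k] pi_gt_zero by linarith
  then show False
    using T'[of "\<tau> k"] above[OF k(2)] by simp
qed

section \<open>Membership in the class and the minimal sets\<close>

lemma homeomorphic_imp_homeomorphic_space:
  assumes "S homeomorphic T"
  shows "top_of_set S homeomorphic_space top_of_set T"
proof -
  obtain f g where fg: "homeomorphism S T f g"
    using assms unfolding homeomorphic_def by blast
  then have "homeomorphic_maps (top_of_set S) (top_of_set T) f g"
    unfolding homeomorphic_maps_def homeomorphism_def by auto
  then show ?thesis
    unfolding homeomorphic_space_def by blast
qed

abbreviation X_top :: "(real \<times> real) topology" where
  "X_top \<equiv> top_of_set carrier"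

lemma subtopology_carrier: "S \<subseteq> carrier \<Longrightarrow> subtopology X_top S = top_of_set S"
  by (simp add: subtopology_subtopology inf.absorb2)

lemma side_subset_carrier: "\<bar>\<sigma>\<bar> = 1 \<Longrightarrow> side \<sigma> \<subseteq> carrier"
  by (auto simp: mem_carrier mem_side)

lemma range_curve_subset_carrier: "range curve \<subseteq> carrier"
  by auto

lemma side_homeomorphic: "side \<sigma> homeomorphic {0..1::real}"
proof -
  have "homeomorphism (side \<sigma>) {0..1::real} (\<lambda>z. (snd z + 1) / 2) (\<lambda>t. (\<sigma>, 2 * t - 1))"
    by (rule homeomorphismI)
      (auto simp: side_def image_subset_iff field_simps intro!: continuous_intros)
  then show ?thesis
    unfolding homeomorphic_def by blast
qed

lemma arc_in_side: "\<bar>\<sigma>\<bar> = 1 \<Longrightarrow> arc_in X_top (side \<sigma>)"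
  unfolding arc_in_def
  by (simp add: subtopology_carrier side_subset_carrier homeomorphic_imp_homeomorphic_space
      side_homeomorphic)

lemma range_curve_homeomorphic: "range curve homeomorphic {0<..<1::real}"
proof -
  have "range curve homeomorphic (UNIV :: real set)"
    using homeomorphism_curve homeomorphic_def homeomorphic_sym by blast
  also have "\<dots> homeomorphic ball (1/2 :: real) (1/2)"
    using homeomorphic_ball_UNIV[of "1/2" "1/2 :: real"] homeomorphic_sym by auto
  also have "ball (1/2 :: real) (1/2) = {0<..<1}"
    by (auto simp: ball_eq_greaterThanLessThan)
  finally show ?thesis .
qed

lemma free_interval_in_range_curve: "free_interval_in X_top (range curve)"
proof -
  have "open {z::real \<times> real. \<bar>fst z\<bar> < 1}"
    by (intro open_Collect_less continuous_intros)
  moreover have "range curve = carrier \<inter> {z. \<bar>fst z\<bar> < 1}"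
    using mem_range_curve_iff_fst range_curve_subset_carrier by blast
  ultimately have "openin X_top (range curve)"
    by (metis openin_open_Int)
  then show ?thesis
    unfolding free_interval_in_def
    by (simp add: subtopology_carrier range_curve_subset_carrier
        homeomorphic_imp_homeomorphic_space range_curve_homeomorphic)
qed

lemma dense_in_range_curve: "dense_in X_top (range curve)"
  using carrier_subset_closure range_curve_subset_carrier
  by (simp add: dense_in_def closure_of_subtopology inf.absorb1 inf.absorb2)

lemma closed_side: "closed (side \<sigma>)"
  by (simp add: side_def closed_Times)

text \<open>The side is closed, and its interior is an open set missing the dense curve.\<close>

lemma nowhere_dense_in_side:
  assumes "\<bar>\<sigma>\<bar> = 1"
  shows "nowhere_dense_in X_top (side \<sigma>)"
proof -
  have "closedin X_top (side \<sigma>)"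
    using closed_side side_subset_carrier[OF assms] by (rule closed_subset[rotated])
  moreover have "X_top interior_of (side \<sigma>) = {}"
  proof -
    have "range curve \<inter> X_top interior_of (side \<sigma>) = {}"
      using side_disjnt_range_curve[OF assms] interior_of_subset[of X_top "side \<sigma>"]
      unfolding disjnt_def by blast
    then show ?thesis
      using dense_in_range_curve openin_interior_of[of X_top "side \<sigma>"]
      unfolding dense_in_def dense_intersects_open by blast
  qed
  ultimately show ?thesis
    unfolding nowhere_dense_in_def
    using side_subset_carrier[OF assms] by (simp add: closure_of_closedin)
qed

lemma sides_disjnt: "disjnt (side 1) (side (-1))"
  by (auto simp: disjnt_iff mem_side)

lemma continuum_space_top_of_set:
  fixes S :: "'a::metric_space set"
  assumes "S \<noteq> {}" "compact S" "connected S"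
  shows "continuum_space (top_of_set S)"
  using assms unfolding continuum_space_def
  by (simp add: compact_space_subtopology connected_space_subtopology
      metrizable_space_subtopology metrizable_space_euclidean)

lemma locally_connected_continuum_in_side:
  assumes "\<bar>\<sigma>\<bar> = 1"
  shows "locally_connected_continuum_in X_top (side \<sigma>)"
proof -
  have hom: "top_of_set (side \<sigma>) homeomorphic_space top_of_set {0..1::real}"
    by (intro homeomorphic_imp_homeomorphic_space side_homeomorphic)
  then have "locally_connected_space (top_of_set (side \<sigma>))"
    by (simp add: homeomorphic_locally_connected_space locally_connected_real_interval)
  moreover have "continuum_space (top_of_set (side \<sigma>))"
  proof (rule continuum_space_top_of_set)
    show "side \<sigma> \<noteq> {}" "compact (side \<sigma>)"
      by (auto simp: side_def compact_Times)
    show "connected (side \<sigma>)"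
      unfolding side_def by (intro connected_Times) auto
  qed
  ultimately show ?thesis
    unfolding locally_connected_continuum_in_def
    using assms by (simp add: subtopology_carrier side_subset_carrier)
qed

text \<open>The rays for 1 and -1 share the point \<open>curve 0\<close>, which is allowed because
  the class asks for a union only.\<close>

definition ray :: "real \<Rightarrow> (real \<times> real) set" where
  "ray \<sigma> = curve ` {t. 0 \<le> \<sigma> * t}"

lemma ray_subset: "ray \<sigma> \<subseteq> range curve"
  by (auto simp: ray_def)

lemma ray_in_ray:
  assumes "\<bar>\<sigma>\<bar> = 1"
  shows "ray_in X_top (ray \<sigma>)"
proof -
  have "\<sigma> = 1 \<or> \<sigma> = - 1"
    using assms by auto
  then have "homeomorphism {0::real..} (ray \<sigma>) (\<lambda>t. curve (\<sigma> * t)) (\<lambda>z. \<sigma> * artanh (fst z))"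
    by (intro homeomorphismI)
      (auto simp: ray_def artanh_tanh_real intro!: continuous_intros
        continuous_on_compose2[OF continuous_on_curve[of UNIV]]
        continuous_on_subset[OF continuous_on_artanh_fst])
  then have "ray \<sigma> homeomorphic {0::real..}"
    using homeomorphic_def homeomorphic_sym by blast
  moreover have "ray \<sigma> \<subseteq> carrier"
    using ray_subset range_curve_subset_carrier by blast
  ultimately show ?thesis
    unfolding ray_in_def
    by (simp add: subtopology_carrier homeomorphic_imp_homeomorphic_space)
qed

text \<open>Side and ray together are the part of \<open>carrier\<close> in a closed half plane,
  hence compact; density of the ray is \<open>side_subset_closure\<close> for the tail from
  0.\<close>

lemma compactification_in_ray:
  assumes "\<bar>\<sigma>\<bar> = 1"
  shows "compactification_in X_top (side \<sigma> \<union> ray \<sigma>) (ray \<sigma>) (side \<sigma>)"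
proof -
  have \<sigma>: "\<sigma> = 1 \<or> \<sigma> = - 1"
    using assms by auto
  have sub: "side \<sigma> \<union> ray \<sigma> \<subseteq> carrier"
    using side_subset_carrier[OF assms] ray_subset range_curve_subset_carrier by blast
  have "z \<in> side \<sigma> \<union> ray \<sigma> \<longleftrightarrow> z \<in> carrier \<and> 0 \<le> \<sigma> * fst z" for z
  proof -
    have ray: "z \<in> ray \<sigma> \<longleftrightarrow> z \<in> range curve \<and> 0 \<le> \<sigma> * fst z"
      using \<sigma> by (auto simp: ray_def)
    have "z \<notin> side (- \<sigma>)" if "0 \<le> \<sigma> * fst z"
      using that \<sigma> by (auto simp: mem_side)
    moreover have "0 \<le> \<sigma> * fst z" if "z \<in> side \<sigma>"
      using that by (auto simp: mem_side)
    moreover have "z \<in> carrier \<longleftrightarrow> z \<in> side \<sigma> \<or> z \<in> range curve \<or> z \<in> side (- \<sigma>)"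
      using \<sigma> unfolding carrier_def by auto
    ultimately show ?thesis
      using ray by blast
  qed
  then have eq: "side \<sigma> \<union> ray \<sigma> = carrier \<inter> {z. 0 \<le> \<sigma> * fst z}"
    by blast
  have "closed {z::real \<times> real. 0 \<le> \<sigma> * fst z}"
    by (intro closed_Collect_le continuous_intros)
  then have "compact (side \<sigma> \<union> ray \<sigma>)"
    unfolding eq using compact_carrier by (rule compact_Int_closed[rotated])
  then have "compact_space (top_of_set (side \<sigma> \<union> ray \<sigma>))"
    by (simp add: compact_space_subtopology)
  moreover have "dense_in (top_of_set (side \<sigma> \<union> ray \<sigma>)) (ray \<sigma>)"
    using side_subset_closure[OF assms, of 0] closure_subset[of "ray \<sigma>"]
    by (auto simp: dense_in_def closure_of_subtopology ray_def Int_absorb1)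
  moreover have "side \<sigma> \<union> ray \<sigma> - ray \<sigma> = side \<sigma>"
    using side_disjnt_range_curve[OF assms] ray_subset[of \<sigma>] unfolding disjnt_def by blast
  ultimately show ?thesis
    unfolding compactification_in_def
    using sub by (simp add: subtopology_carrier Hausdorff_space_subtopology)
qed

text \<open>The role of \<open>L\<close> is taken by the segment at the right end of the picture and
  that of \<open>R\<close> by the one at the left end.\<close>

lemma class_C_carrier: "class_C X_top (side 1) (range curve) (side (-1))"
proof -
  have "curve 0 \<in> carrier"
    by simp
  then have "carrier \<noteq> {}"
    by blast
  then have "continuum_space X_top"
    using compact_carrier connected_carrier by (rule continuum_space_top_of_set)
  moreover have "\<exists>JL JR. ray_in X_top JL \<and> ray_in X_top JR \<and> range curve = JL \<union> JR \<and>
      compactification_in X_top (side 1 \<union> JL) JL (side 1) \<and>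
      compactification_in X_top (side (-1) \<union> JR) JR (side (-1))"
  proof (intro exI conjI)
    show "range curve = ray 1 \<union> ray (-1)"
      unfolding ray_def image_Un[symmetric] by (intro image_cong) auto
  qed (simp_all add: ray_in_ray compactification_in_ray)
  moreover have "topspace X_top = side 1 \<union> range curve \<union> side (-1)"
    by (simp add: carrier_def)
  ultimately show ?thesis
    unfolding class_C_def
    by (simp only: free_interval_in_range_curve dense_in_range_curve nowhere_dense_in_side
        locally_connected_continuum_in_side side_disjnt_range_curve abs_minus abs_one simp_thms)
qed

section \<open>Confinement of minimal sets to one piece\<close>

lemma invariant_set_cases:
  assumes "M \<subseteq> L \<union> J \<union> R" "f ` M = M"
    and minL: "f ` L \<subseteq> L \<Longrightarrow> M \<subseteq> L \<or> M \<inter> L = {}"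
    and minR: "f ` R \<subseteq> R \<Longrightarrow> M \<subseteq> R \<or> M \<inter> R = {}"
    and L: "f ` L \<subseteq> L \<or> f ` L \<subseteq> J \<or> f ` L \<subseteq> R"
    and R: "f ` R \<subseteq> L \<or> f ` R \<subseteq> J \<or> f ` R \<subseteq> R"
    and J: "f ` J \<subseteq> J" and swap: "\<not> (f ` L \<subseteq> R \<and> f ` R \<subseteq> L)"
  shows "M \<subseteq> L \<or> M \<subseteq> J \<or> M \<subseteq> R"
proof -
  \<comment> \<open>Minimality enters this set-theoretic argument only through \<open>minL\<close>
    and \<open>minR\<close>. A set equal to its image lies in \<open>J\<close> once a set containing
    it is mapped into \<open>J\<close>.\<close>
  have absorbed: "M \<subseteq> J" if "M \<subseteq> A" "f ` A \<subseteq> J" for A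
    using image_mono[OF that(1), of f] that(2) assms(2) by simp
  consider "f ` L \<subseteq> L" "f ` R \<subseteq> R" | "f ` L \<subseteq> L" "f ` R \<subseteq> J" | "f ` L \<subseteq> L" "f ` R \<subseteq> L"
    | "f ` L \<subseteq> J" "f ` R \<subseteq> R" | "f ` L \<subseteq> J" "f ` R \<subseteq> J" | "f ` L \<subseteq> J" "f ` R \<subseteq> L"
    | "f ` L \<subseteq> R" "f ` R \<subseteq> R" | "f ` L \<subseteq> R" "f ` R \<subseteq> J"
    using L R swap by argo
  then show ?thesis
  proof cases
    case 1
    show ?thesis using assms(1) minL[OF 1(1)] minR[OF 1(2)] by blast
  next
    case 2
    have "M \<subseteq> L \<or> M \<subseteq> J \<union> R" using assms(1) minL[OF 2(1)] by blast
    then show ?thesis using absorbed[of "J \<union> R"] 2(2) J by (auto simp: image_Un)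
  next
    case 3
    \<comment> \<open>If \<open>M\<close> misses \<open>L\<close>, this inclusion forces it to miss
      \<open>R\<close> as well.\<close>
    have "f ` (M \<inter> R) \<subseteq> M \<inter> L" using 3(2) assms(2) by blast
    then show ?thesis using assms(1) minL[OF 3(1)] by blast
  next
    case 4
    have "M \<subseteq> R \<or> M \<subseteq> J \<union> L" using assms(1) minR[OF 4(2)] by blast
    then show ?thesis using absorbed[of "J \<union> L"] 4(1) J by (auto simp: image_Un)
  next
    case 5
    then show ?thesis using absorbed[OF assms(1)] J by (simp add: image_Un)
  next
    case 6
    \<comment> \<open>Here \<open>R\<close> reaches \<open>J\<close> only through \<open>L\<close>,
      so the equality of \<open>M\<close> with its image is used twice.\<close>
    then have "f ` (L \<union> J \<union> R) \<subseteq> J \<union> L"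
      using J by (simp add: image_Un le_supI1 le_supI2)
    then have "M \<subseteq> J \<union> L" using image_mono[OF assms(1), of f] assms(2) by simp
    then show ?thesis using absorbed[of "J \<union> L"] 6(1) J by (simp add: image_Un)
  next
    case 7
    have "f ` (M \<inter> L) \<subseteq> M \<inter> R" using 7(1) assms(2) by blast
    then show ?thesis using assms(1) minR[OF 7(2)] by blast
  next
    case 8
    then have "f ` (L \<union> J \<union> R) \<subseteq> J \<union> R"
      using J by (simp add: image_Un le_supI1 le_supI2)
    then have "M \<subseteq> J \<union> R" using image_mono[OF assms(1), of f] assms(2) by simp
    then show ?thesis using absorbed[of "J \<union> R"] 8(2) J by (simp add: image_Un)
  qed
qed

lemma minimal_set_in_piece:
  assumes "M \<in> minimal_sets X_top"
  shows "M \<subseteq> side 1 \<or> M \<subseteq> range curve \<or> M \<subseteq> side (-1)"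
proof -
  obtain f where M: "M \<subseteq> carrier" "f ` M = M"
    and f: "continuous_on carrier f" "f ` carrier \<subseteq> carrier"
    and min: "minimal_map (subtopology X_top M) f"
    using assms unfolding minimal_sets_def
    by (auto simp: compactin_subtopology image_subset_iff_funcset)
  have cases: "f ` S \<subseteq> side 1 \<or> f ` S \<subseteq> range curve \<or> f ` S \<subseteq> side (-1)"
    if "S \<in> {side 1, range curve, side (-1)}" for S
    using image_cases[OF f that] .
  have inv: "M \<subseteq> side \<sigma> \<or> M \<inter> side \<sigma> = {}" if "f ` side \<sigma> \<subseteq> side \<sigma>" for \<sigma>
  proof -
    have "closedin (top_of_set M) (M \<inter> side \<sigma>)"
      using closed_side by (simp add: closedin_closed_Int)
    moreover have "f ` (M \<inter> side \<sigma>) \<subseteq> M \<inter> side \<sigma>"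
      using M(2) that by blast
    ultimately show ?thesis
      using minimal_map_closed_invariant[of "top_of_set M" f "M \<inter> side \<sigma>"] min M(1)
      by (auto simp: subtopology_carrier)
  qed
  \<comment> \<open>The curve is dense and the side closed, so by continuity all of
    \<open>carrier\<close> is mapped into the side.\<close>
  have absorb: "M \<subseteq> side \<sigma>" if "f ` range curve \<subseteq> side \<sigma>" for \<sigma>
  proof -
    have "closure (range curve) \<subseteq> carrier"
      by (intro closure_minimal range_curve_subset_carrier compact_imp_closed compact_carrier)
    then have "continuous_on (closure (range curve)) f"
      by (rule continuous_on_subset[OF f(1)])
    then have "f ` closure (range curve) \<subseteq> side \<sigma>"
      using closed_side that by (rule image_closure_subset)
    then show ?thesis
      using image_mono[OF order_trans[OF M(1) carrier_subset_closure], of f] M(2) by simp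
  qed
  show ?thesis
  proof (cases "f ` range curve \<subseteq> range curve")
    case True
    show ?thesis
    proof (rule invariant_set_cases[where f = f])
      show "M \<subseteq> side 1 \<union> range curve \<union> side (-1)"
        using M(1) unfolding carrier_def .
      show "\<not> (f ` side 1 \<subseteq> side (-1) \<and> f ` side (-1) \<subseteq> side 1)"
        using no_side_swap[OF f True] by blast
    qed (use M(2) inv True cases[of "side 1"] cases[of "side (-1)"] in auto)
  next
    case False
    then show ?thesis
      using cases[of "range curve"] absorb by blast
  qed
qed

theorem mainTheorem7:
  "\<exists>(X :: continuum_points topology) L J R.
     class_C X L J R \<and> arc_in X L \<and> arc_in X R \<and> disjnt L R \<and>
     minimal_sets X =
       minimal_sets (subtopology X J) \<union> minimal_sets (subtopology X L) \<union>
       minimal_sets (subtopology X R) \<and>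
     disjnt (minimal_sets (subtopology X J)) (minimal_sets (subtopology X L)) \<and>
     disjnt (minimal_sets (subtopology X J)) (minimal_sets (subtopology X R)) \<and>
     disjnt (minimal_sets (subtopology X L)) (minimal_sets (subtopology X R))"
proof -
  have met: "metrizable_space X_top"
    by (simp add: metrizable_space_subtopology metrizable_space_euclidean)
  have J: "minimal_sets (subtopology X_top (range curve)) =
      {M \<in> minimal_sets X_top. M \<subseteq> range curve}"
    by (rule minimal_sets_interval_subspace[OF met, where T = "{0<..<1}"])
      (simp_all add: range_curve_subset_carrier subtopology_carrier
        homeomorphic_imp_homeomorphic_space range_curve_homeomorphic is_interval_oo)
  have side: "minimal_sets (subtopology X_top (side \<sigma>)) = {M \<in> minimal_sets X_top. M \<subseteq> side \<sigma>}"
    if "\<bar>\<sigma>\<bar> = 1" for \<sigma>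
    by (rule minimal_sets_interval_subspace[OF met, where T = "{0..1}"])
      (simp_all add: side_subset_carrier[OF that] subtopology_carrier
        homeomorphic_imp_homeomorphic_space side_homeomorphic is_interval_cc)
  \<comment> \<open>Disjoint pieces have only the empty set as a common subset, so the systems are
    disjoint because their members are nonempty.\<close>
  have nonempty: "M \<noteq> {}" if "M \<in> minimal_sets X_top" for M
    using that unfolding minimal_sets_def by blast
  have disj: "disjnt (range curve) (side 1)" "disjnt (range curve) (side (-1))"
    using side_disjnt_range_curve[of 1] side_disjnt_range_curve[of "-1"]
    by (simp_all add: disjnt_sym)
  have disjoint: "disjnt {M \<in> minimal_sets X_top. M \<subseteq> A} {M \<in> minimal_sets X_top. M \<subseteq> B}"
    if "disjnt A B" for A B
    using that nonempty unfolding disjnt_def by blast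
  show ?thesis
  proof (intro exI conjI)
    show "class_C X_top (side 1) (range curve) (side (-1))"
      by (rule class_C_carrier)
    show "minimal_sets X_top = minimal_sets (subtopology X_top (range curve)) \<union>
        minimal_sets (subtopology X_top (side 1)) \<union> minimal_sets (subtopology X_top (side (-1)))"
      using minimal_set_in_piece by (auto simp: J side)
    show "disjnt (minimal_sets (subtopology X_top (range curve)))
        (minimal_sets (subtopology X_top (side 1)))"
      "disjnt (minimal_sets (subtopology X_top (range curve)))
        (minimal_sets (subtopology X_top (side (-1))))"
      "disjnt (minimal_sets (subtopology X_top (side 1)))
        (minimal_sets (subtopology X_top (side (-1))))"
      unfolding J side[of 1, simplified] side[of "-1", simplified]
      by (intro disjoint disj sides_disjnt)+
  qed (simp_all add: arc_in_side sides_disjnt)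
qed

end
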